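(* For every integer $n\ge 0$, the map $\alpha:\mathfrak{M}_n\to\mathcal{M}_n$ is bijective, and its restriction to $\mathfrak{R}_n$ provides a bijection between $\mathfrak{R}_n$ and $\mathcal{R}_n$.
   Context: A Motzkin path of length $n$ is a lattice path from $(0,0)$ to $(n,0)$ with steps $\mathsf{U}=(1,1)$, $\mathsf{H}=(1,0)$, $\mathsf{D}=(1,-1)$ that never goes below the $x$-axis; it is identified with the word $w_1\cdots w_n$ of its steps. A Riordan path is a Motzkin path with no $\mathsf{H}$-step on the $x$-axis. Let $\mathcal{M}_n$ and $\mathcal{R}_n$ be the sets of Motzkin and Riordan paths of length $n$, respectively. For a permutation $\pi=\pi_1\cdots\pi_n$ of $[n]=\{1,\dots,n\}$, an entry $\pi_i$ is a left-to-right (LR) maximum if $\pi_i>\pi_j$ for all $j<i$; $\mathrm{LR}(\pi)$ denotes the set of LR maxima (as values). Let $\mathfrak{M}_n$ be the set of $321$-avoiding permutations $\pi$ of $[n]$ such that every LR maximum $\pi_i$ is a descent (i.e. $i<n$ and $\pi_i>\pi_{i+1}$) or a fixed point (i.e. $\pi_i=i$); for $i=n$ only the latter can occur. Let $\mathfrak{R}_n$ be the set of fixed-point-free permutations in $\mathfrak{M}_n$. For $\pi\in\mathfrak{M}_n$ let $$D(\pi)=\{\pi_i:\pi_i\in\mathrm{LR}(\pi),\ \pi_i\ne i\},\qquad U(\pi)=\{\pi_{i+1}:\pi_i\in D(\pi)\}.$$ These sets are disjoint. Define $\alpha(\pi)=w_1\cdots w_n$ by $w_v=\mathsf{D}$ if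 $v\in D(\pi)$, $w_v=\mathsf{U}$ if $v\in U(\pi)$, and $w_v=\mathsf{H}$ otherwise. This word is a Motzkin path of length $n$. *)

theory Defs
  imports "HOL-Combinatorics.Permutations"
begin

(* A lattice path starting at the origin is represented by its word of steps,
   U = (1,1), H = (1,0), D = (1,-1).  Every step advances the abscissa by 1, so the vertex reached
   after i steps is (i, height (take i w)). *)

datatype step = U | H | D

fun rise :: "step \<Rightarrow> int" where
  "rise U = 1"
| "rise H = 0"
| "rise D = - 1"

definition height :: "step list \<Rightarrow> int" where
  "height w = sum_list (map rise w)"

definition motzkin_paths :: "nat \<Rightarrow> step list set" where
  "motzkin_paths n =
     {w. length w = n \<and> height w = 0 \<and> (\<forall>i\<le>n. 0 \<le> height (take i w))}"

definition riordan_paths :: "nat \<Rightarrow> step list set" where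
  "riordan_paths n =
     {w \<in> motzkin_paths n. \<not> (\<exists>i<n. w ! i = H \<and> height (take i w) = 0)}"

(* A permutation of [n] is a function p with "p permutes {1..n}"; it is the identity outside
   {1..n}, so it is determined by its values on [n].  All indices are kept inside [n]. *)

definition avoids_321 :: "nat \<Rightarrow> (nat \<Rightarrow> nat) \<Rightarrow> bool" where
  "avoids_321 n p \<longleftrightarrow>
     \<not> (\<exists>i j k. 1 \<le> i \<and> i < j \<and> j < k \<and> k \<le> n \<and> p i > p j \<and> p j > p k)"

(* Left-to-right maxima, as values rather than positions. *)
definition LR :: "nat \<Rightarrow> (nat \<Rightarrow> nat) \<Rightarrow> nat set" where
  "LR n p = {p i |i. i \<in> {1..n} \<and> (\<forall>j\<in>{1..<i}. p j < p i)}"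

definition perms_M :: "nat \<Rightarrow> (nat \<Rightarrow> nat) set" where
  "perms_M n =
     {p. p permutes {1..n} \<and> avoids_321 n p \<and>
         (\<forall>i\<in>{1..n}. p i \<in> LR n p \<longrightarrow> (i < n \<and> p i > p (i + 1)) \<or> p i = i)}"

definition perms_R :: "nat \<Rightarrow> (nat \<Rightarrow> nat) set" where
  "perms_R n = {p \<in> perms_M n. \<forall>i\<in>{1..n}. p i \<noteq> i}"

definition D_set :: "nat \<Rightarrow> (nat \<Rightarrow> nat) \<Rightarrow> nat set" where
  "D_set n p = {p i |i. i \<in> {1..n} \<and> p i \<in> LR n p \<and> p i \<noteq> i}"

(* For p in perms_M n, p i \<in> D_set n p already forces i < n. *)
definition U_set :: "nat \<Rightarrow> (nat \<Rightarrow> nat) \<Rightarrow> nat set" where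
  "U_set n p = {p (i + 1) |i. i \<in> {1..<n} \<and> p i \<in> D_set n p}"

(* The letters are indexed by the values v = 1, ..., n.  D_set and U_set are disjoint on perms_M n,
   so the order of the two tests is immaterial there. *)
definition alpha :: "nat \<Rightarrow> (nat \<Rightarrow> nat) \<Rightarrow> step list" where
  "alpha n p =
     map (\<lambda>v. if v \<in> D_set n p then D else if v \<in> U_set n p then U else H) [1..<n + 1]"

end

theory Submission
  imports Defs
begin

text \<open>
  Call \<open>i\<close> an excedance of \<open>p\<close> if \<open>i < p i\<close>.  In a 321-avoiding permutation every weak excedance
  \<open>i \<le> p i\<close> is a left-to-right maximum (an earlier larger entry would, by pigeonhole, force a later
  smaller one), and conversely every left-to-right maximum is a weak excedance.  Hence the sets
  \<open>D(p)\<close> and \<open>U(p)\<close> are the images under \<open>p\<close> of the set \<open>E\<close> of excedances and of its shift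
  \<open>E + 1\<close>, and membership in \<open>perms_M\<close> means that \<open>p\<close> is increasing on \<open>E\<close>, increasing off \<open>E\<close>, and
  maps \<open>i + 1\<close> to at most \<open>i\<close> for each \<open>i \<in> E\<close> (\<open>perms_M_iff\<close>).

  Everything is read off one formula.  Let \<open>h(v)\<close> be the height of the word after \<open>v\<close> letters, that
  is, the number of values \<open>\<le> v\<close> in \<open>U(p)\<close> minus the number of those in \<open>D(p)\<close>.  A value \<open>v\<close> outside
  \<open>D(p)\<close> is preceded in the one-line notation of \<open>p\<close> by the smaller values outside \<open>D(p)\<close> and by the
  excedance values standing immediately before some element of \<open>U(p)\<close> that is at most \<open>v\<close>; so \<open>v\<close>
  stands at position \<open>v + h(v)\<close> (\<open>position_of_non_excedance\<close>).

  \<^item> The word is a Motzkin path, because the entry of \<open>U(p)\<close> following an entry of \<open>D(p)\<close> is the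
    smaller of the two.

  \<^item> The map is injective: the word determines \<open>D(p)\<close>, \<open>U(p)\<close> and \<open>h\<close>, hence the positions of all
    values outside \<open>D(p)\<close>; the remaining positions are filled by \<open>D(p)\<close> in increasing order.

  \<^item> The map is surjective: from a path, place each value \<open>v\<close> that is not a down-step at position
    \<open>v + h(v)\<close>, and place the \<open>k\<close>-th down-step immediately before the \<open>k\<close>-th up-step
    (\<open>ex_perm_of_ballot_pair\<close>).  Positions \<open>v + h(v)\<close> grow by 1 at a level step and by 2 at an
    up-step, and the gaps left by the up-steps are exactly what the down-steps fill.

  \<^item> A level step at \<open>v\<close> lies on the axis iff \<open>h(v) = 0\<close>, iff \<open>v\<close> stands at position \<open>v\<close>.  So Riordan
    paths correspond to permutations without fixed points (\<open>alpha_riordan_iff\<close>).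
\<close>

section \<open>Excedances and left-to-right maxima\<close>

definition exceed :: "(nat \<Rightarrow> nat) \<Rightarrow> nat set" where
  "exceed p = {i. i < p i}"

lemma LR_at_iff:
  assumes "p permutes {1..n}" "i \<in> {1..n}"
  shows "p i \<in> LR n p \<longleftrightarrow> (\<forall>j<i. p j < p i)"
proof -
  have inj: "inj p" using assms(1) by (rule permutes_inj)
  have 0: "p 0 = 0" using assms(1) by (simp add: permutes_not_in)
  have pos: "0 < p i" using assms permutes_in_image[OF assms(1), of i] by auto
  have "p i \<in> LR n p \<longleftrightarrow> (\<forall>j\<in>{1..<i}. p j < p i)"
    using assms(2) by (auto simp: LR_def inj_eq[OF inj])
  also have "\<dots> \<longleftrightarrow> (\<forall>j<i. p j < p i)"
    using 0 pos by (metis atLeastLessThan_iff less_one not_le)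
  finally show ?thesis .
qed

text \<open>The values at the \<open>i\<close> positions \<open>0, \<dots>, i - 1\<close> are distinct and all below \<open>p i\<close>.\<close>

lemma record_weak_excedance:
  fixes p :: "nat \<Rightarrow> nat"
  assumes "inj p" "\<forall>j<i. p j < p i"
  shows "i \<le> p i"
proof -
  have "card (p ` {..<i}) \<le> card {..<p i}"
    using assms(2) by (intro card_mono) auto
  then show ?thesis using assms(1) by (simp add: card_image inj_on_subset)
qed

text \<open>
  If \<open>p j > p i\<close> with \<open>j < i\<close>, then avoidance of 321 leaves no smaller value to the right of \<open>i\<close>.
  All \<open>p i + 1\<close> values up to \<open>p i\<close> (counting 0, which is fixed) then sit at the \<open>i\<close> positions
  up to \<open>i\<close> other than \<open>j\<close>, which is impossible when \<open>i \<le> p i\<close>.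
\<close>

lemma weak_excedance_record:
  assumes p: "p permutes {1..n}" and av: "avoids_321 n p" and i: "i \<le> p i" and ji: "j < i"
  shows "p j < p i"
proof (rule ccontr)
  have inj: "inj p" using p by (rule permutes_inj)
  assume "\<not> p j < p i"
  then have gt: "p i < p j" using ji inj by (metis inj_eq linorder_neqE_nat less_irrefl)
  have 0: "p 0 = 0" using p by (simp add: permutes_not_in)
  have j1: "1 \<le> j" using gt 0 by (cases j) auto
  have later: "i < k \<Longrightarrow> p i < p k" for k
  proof (cases "k \<le> n")
    case True
    assume "i < k"
    then have "\<not> p k < p i" using av gt j1 ji True unfolding avoids_321_def by blast
    then show ?thesis using \<open>i < k\<close> inj by (metis inj_eq linorder_neqE_nat less_irrefl)
  next
    case False
    have "j \<le> n"
    proof (rule ccontr)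
      assume "\<not> j \<le> n"
      then have "p j = j" by (intro permutes_not_in[OF p]) auto
      then show False using gt i ji by simp
    qed
    then have "p j \<le> n" using permutes_in_image[OF p, of j] j1 by auto
    moreover have "p k = k" using False by (auto intro!: permutes_not_in[OF p])
    ultimately show ?thesis using gt False by simp
  qed
  have "inv p ` {..p i} \<subseteq> {..i} - {j}"
  proof
    fix k assume "k \<in> inv p ` {..p i}"
    then have "p k \<le> p i" by (auto simp: permutes_inverses(1)[OF p])
    then show "k \<in> {..i} - {j}" using later[of k] gt by force
  qed
  then have "card (inv p ` {..p i}) \<le> card ({..i} - {j})" by (intro card_mono) auto
  moreover have "card (inv p ` {..p i}) = Suc (p i)"
    using permutes_inj[OF permutes_inv[OF p]] by (simp add: card_image inj_on_subset)
  ultimately show False using i ji by simp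
qed

text \<open>
  The intrinsic form of the class, in which values outside \<open>{1..n}\<close> do no harm: they are fixed, hence
  not excedances, and respect the monotonicity.  Conversely, 321 is avoided because any three
  positions contain two of the same kind.
\<close>

lemma perms_M_iff:
  "p \<in> perms_M n \<longleftrightarrow> p permutes {1..n} \<and> strict_mono_on (exceed p) p \<and>
     strict_mono_on (- exceed p) p \<and> (\<forall>i\<in>exceed p. p (Suc i) \<le> i)"
  (is "?L \<longleftrightarrow> ?R")
proof
  assume L: ?L
  then have p: "p permutes {1..n}" and av: "avoids_321 n p"
    and desc: "\<And>i. i \<in> {1..n} \<Longrightarrow> p i \<in> LR n p \<Longrightarrow> (i < n \<and> p i > p (i + 1)) \<or> p i = i"
    by (auto simp: perms_M_def)
  have inj: "inj p" using p by (rule permutes_inj)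
  note rec = weak_excedance_record[OF p av]
  have "strict_mono_on (exceed p) p"
    by (auto simp: exceed_def intro!: strict_mono_onI rec)
  moreover have "strict_mono_on (- exceed p) p"
  proof (rule strict_mono_onI, rule ccontr)
    fix i j assume i: "i \<in> - exceed p" and j: "j \<in> - exceed p" and ij: "i < j" and "\<not> p i < p j"
    then have gt: "p j < p i" using inj by (metis inj_eq linorder_neqE_nat less_irrefl)
    have jn: "j \<le> n"
    proof (rule ccontr)
      assume "\<not> j \<le> n"
      then have "p j = j" by (intro permutes_not_in[OF p]) auto
      then show False using gt ij i by (simp add: exceed_def)
    qed
    \<comment> \<open>As \<open>p j\<close> is smaller and later, nothing before \<open>i\<close> exceeds \<open>p i\<close>; then \<open>i + 2\<close> positions have
        values in \<open>{..p i}\<close>, which makes \<open>i\<close> an excedance.\<close>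
    have earlier: "p k \<le> p i" if "k < i" for k
    proof (rule ccontr)
      assume "\<not> p k \<le> p i"
      moreover from this have "1 \<le> k" using permutes_not_in[OF p, of 0] by (cases k) auto
      ultimately show False using av gt ij that jn unfolding avoids_321_def by auto
    qed
    have "p k \<le> p i" if "k \<in> insert j {..i}" for k
      using that gt earlier[of k] by (cases "k = i") auto
    then have "p ` insert j {..i} \<subseteq> {..p i}" by blast
    then have "card (p ` insert j {..i}) \<le> card {..p i}" by (intro card_mono) auto
    moreover have "card (p ` insert j {..i}) = card (insert j {..i})"
      using inj_on_subset[OF inj subset_UNIV] by (rule card_image)
    moreover have "card (insert j {..i}) = Suc (Suc i)" using ij by simp
    ultimately show False using i by (simp add: exceed_def)
  qed
  moreover have "p (Suc i) \<le> i" if i: "i \<in> exceed p" for i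
  proof -
    have i1: "i \<in> {1..n}" using i permutes_not_in[OF p, of i] by (auto simp: exceed_def)
    have "\<forall>j<i. p j < p i" using rec i by (auto simp: exceed_def)
    then have "p i \<in> LR n p" using LR_at_iff[OF p i1] by simp
    then have "p (Suc i) < p i" using desc[OF i1] i by (auto simp: exceed_def)
    \<comment> \<open>If \<open>p (Suc i) \<ge> Suc i\<close>, then \<open>Suc i\<close> would be a left-to-right maximum.\<close>
    then show ?thesis using rec[of "Suc i" i] by linarith
  qed
  ultimately show ?R using p by blast
next
  assume R: ?R
  then have p: "p permutes {1..n}"
    and mE: "\<And>i j. i \<in> exceed p \<Longrightarrow> j \<in> exceed p \<Longrightarrow> i < j \<Longrightarrow> p i < p j"
    and mN: "\<And>i j. i \<notin> exceed p \<Longrightarrow> j \<notin> exceed p \<Longrightarrow> i < j \<Longrightarrow> p i < p j"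
    and nxt: "\<And>i. i \<in> exceed p \<Longrightarrow> p (Suc i) \<le> i"
    by (auto simp: strict_mono_on_def)
  have "avoids_321 n p"
    unfolding avoids_321_def
  proof (rule notI, elim exE conjE)
    fix i j k assume "i < j" "j < k" "p j < p i" "p k < p j"
    then show False using mE[of i j] mE[of j k] mE[of i k] mN[of i j] mN[of j k] mN[of i k]
      by linarith
  qed
  moreover have "i < n \<and> p i > p (i + 1) \<or> p i = i" if i: "i \<in> {1..n}" "p i \<in> LR n p" for i
  proof (cases "p i = i")
    case False
    have "i \<le> p i"
      using record_weak_excedance[OF permutes_inj[OF p], of i] LR_at_iff[OF p i(1)] i(2) by simp
    then have "i < p i" using False by simp
    moreover have "p i \<le> n" using permutes_in_image[OF p, of i] i(1) by simp
    moreover have "p (Suc i) \<le> i" using nxt[of i] \<open>i < p i\<close> by (simp add: exceed_def)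
    ultimately show ?thesis by simp
  qed simp
  ultimately show ?L using p by (auto simp: perms_M_def)
qed

lemma exceed_subset:
  assumes "p permutes {1..n}"
  shows "exceed p \<subseteq> {1..<n}"
proof
  fix i assume i: "i \<in> exceed p"
  then have "i \<in> {1..n}" using permutes_not_in[OF assms, of i] by (auto simp: exceed_def)
  moreover from this have "p i \<le> n" using permutes_in_image[OF assms, of i] by simp
  ultimately show "i \<in> {1..<n}" using i by (auto simp: exceed_def)
qed

lemma D_set_eq:
  assumes "p \<in> perms_M n"
  shows "D_set n p = p ` exceed p"
proof -
  have p: "p permutes {1..n}" and av: "avoids_321 n p"
    using assms by (auto simp: perms_M_def)
  have "p i \<in> LR n p \<and> p i \<noteq> i \<longleftrightarrow> i \<in> exceed p" if "i \<in> {1..n}" for i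
    using LR_at_iff[OF p that] record_weak_excedance[OF permutes_inj[OF p], of i]
      weak_excedance_record[OF p av, of i] by (fastforce simp: exceed_def)
  then show ?thesis using exceed_subset[OF p] unfolding D_set_def by fastforce
qed

lemma U_set_eq:
  assumes "p \<in> perms_M n"
  shows "U_set n p = p ` Suc ` exceed p"
proof -
  have p: "p permutes {1..n}" using assms by (auto simp: perms_M_def)
  have "p i \<in> D_set n p \<longleftrightarrow> i \<in> exceed p" for i
    by (simp add: D_set_eq[OF assms] inj_image_mem_iff[OF permutes_inj[OF p]])
  then have "U_set n p = {p (Suc i) |i. i \<in> {1..<n} \<and> i \<in> exceed p}"
    by (simp add: U_set_def)
  then show ?thesis using exceed_subset[OF p] by blast
qed

section \<open>Motzkin paths as ballot pairs of sets\<close>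

definition rank :: "nat set \<Rightarrow> nat \<Rightarrow> nat" where
  "rank S v = card (S \<inter> {..v})"

text \<open>The shift by one makes letters indexed by \<open>1, \<dots>, n\<close>, like the values of a permutation.\<close>

definition places :: "step \<Rightarrow> step list \<Rightarrow> nat set" where
  "places s w = Suc ` {k. k < length w \<and> w ! k = s}"

lemma finite_places [simp]: "finite (places s w)"
  by (simp add: places_def)

lemma places_subset: "places s w \<subseteq> {1..length w}"
  by (auto simp: places_def)

lemma rank_Suc: "rank S (Suc v) = rank S v + (if Suc v \<in> S then 1 else 0)"
proof -
  have "S \<inter> {..Suc v} = (if Suc v \<in> S then insert (Suc v) (S \<inter> {..v}) else S \<inter> {..v})"
    by (auto simp: atMost_Suc)
  then show ?thesis by (simp add: rank_def)
qed

lemma height_take_rank: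
  "v \<le> length w \<Longrightarrow> height (take v w) = int (rank (places U w) v) - int (rank (places D w) v)"
proof (induction v)
  case 0
  show ?case by (auto simp: height_def rank_def places_def)
next
  case (Suc v)
  then have "height (take (Suc v) w) = height (take v w) + rise (w ! v)"
    by (simp add: height_def take_Suc_conv_app_nth)
  moreover have "Suc v \<in> places s w \<longleftrightarrow> w ! v = s" for s
    using Suc.prems by (auto simp: places_def)
  ultimately show ?case using Suc by (cases "w ! v") (auto simp: rank_Suc)
qed

lemma rank_full: "S \<subseteq> {1..n} \<Longrightarrow> n \<le> v \<Longrightarrow> rank S v = card S"
  unfolding rank_def by (rule arg_cong[of _ _ card]) auto

lemma motzkin_paths_iff:
  "w \<in> motzkin_paths n \<longleftrightarrow> length w = n \<and> card (places U w) = card (places D w) \<and>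
     (\<forall>v. rank (places D w) v \<le> rank (places U w) v)"
  (is "?L \<longleftrightarrow> ?R")
proof (cases "length w = n")
  case len: True
  have tot: "rank (places s w) v = card (places s w)" if "n \<le> v" for s v
    using rank_full[OF places_subset, of w v s] that len by simp
  have "height w = int (card (places U w)) - int (card (places D w))"
    using height_take_rank[of n w] len tot[of n] by simp
  moreover have "(\<forall>i\<le>n. 0 \<le> height (take i w)) \<longleftrightarrow>
      (\<forall>v\<le>n. rank (places D w) v \<le> rank (places U w) v)"
    using height_take_rank[of _ w] len by auto
  moreover have "(\<forall>v\<le>n. rank (places D w) v \<le> rank (places U w) v) \<longleftrightarrow>
      (\<forall>v. rank (places D w) v \<le> rank (places U w) v)"
    using tot by (metis le_refl nat_le_linear)
  ultimately show ?thesis using len by (auto simp: motzkin_paths_def)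
qed (simp add: motzkin_paths_def)

lemma word_eqI:
  assumes "length w = length w'" "places U w = places U w'" "places D w = places D w'"
  shows "w = w'"
proof (rule nth_equalityI[OF assms(1)])
  fix k assume k: "k < length w"
  have "w ! k = s \<longleftrightarrow> w' ! k = s" if "s = U \<or> s = D" for s
  proof -
    have "Suc k \<in> places s w \<longleftrightarrow> Suc k \<in> places s w'" using assms that by auto
    then show ?thesis using k assms(1) by (auto simp: places_def)
  qed
  then show "w ! k = w' ! k" by (metis step.exhaust)
qed

section \<open>The word of a permutation\<close>

lemma length_alpha [simp]: "length (alpha n p) = n"
  by (simp add: alpha_def)

lemma nth_alpha:
  "k < n \<Longrightarrow> alpha n p ! k =
     (if Suc k \<in> D_set n p then D else if Suc k \<in> U_set n p then U else H)"
  unfolding alpha_def by (subst nth_map) (simp_all del: upt_Suc)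

lemma perms_M_facts:
  assumes "p \<in> perms_M n"
  shows "p permutes {1..n}" "inj p"
    and "\<And>i. i \<in> exceed p \<Longrightarrow> p (Suc i) \<le> i"
    and "\<And>i. i \<in> exceed p \<Longrightarrow> Suc i \<notin> exceed p"
  using assms permutes_inj unfolding perms_M_iff by (force simp: exceed_def)+

lemma places_alpha:
  assumes "p \<in> perms_M n"
  shows "places D (alpha n p) = p ` exceed p"
    and "places U (alpha n p) = p ` Suc ` exceed p"
proof -
  note p = perms_M_facts[OF assms]
  have sub: "p ` exceed p \<subseteq> {1..n}" "p ` Suc ` exceed p \<subseteq> {1..n}"
    using exceed_subset[OF p(1)] permutes_image[OF p(1)] by fastforce+
  have disj: "p ` exceed p \<inter> p ` Suc ` exceed p = {}"
    using p(4) by (auto simp: inj_eq[OF p(2)])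
  define A B where "A = p ` Suc ` exceed p" and "B = p ` exceed p"
  have places: "places s (alpha n p) =
      {v \<in> {1..n}. (if v \<in> B then D else if v \<in> A then U else H) = s}" for s
  proof (rule set_eqI)
    fix v
    show "v \<in> places s (alpha n p) \<longleftrightarrow>
        v \<in> {v \<in> {1..n}. (if v \<in> B then D else if v \<in> A then U else H) = s}"
      by (cases v)
        (auto simp: places_def nth_alpha D_set_eq[OF assms] U_set_eq[OF assms] simp flip: A_def B_def)
  qed
  have "A \<subseteq> {1..n}" "B \<subseteq> {1..n}" "B \<inter> A = {}"
    unfolding A_def B_def using sub disj by simp_all
  then have "places D (alpha n p) = B" "places U (alpha n p) = A"
    unfolding places by (auto split: if_splits)
  then show "places D (alpha n p) = p ` exceed p" "places U (alpha n p) = p ` Suc ` exceed p"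
    by (simp_all add: A_def B_def)
qed

lemma rank_image:
  assumes "inj f"
  shows "rank (f ` A) v = card {i \<in> A. f i \<le> v}"
proof -
  have "f ` A \<inter> {..v} = f ` {i \<in> A. f i \<le> v}" by auto
  then show ?thesis using assms by (simp add: rank_def card_image inj_on_subset)
qed

lemma ranks_of_perm:
  assumes "p \<in> perms_M n"
  shows "rank (p ` exceed p) v = card {i \<in> exceed p. p i \<le> v}"
    and "rank (p ` Suc ` exceed p) v = card {i \<in> exceed p. p (Suc i) \<le> v}"
  using rank_image[of p "exceed p" v] rank_image[of "p \<circ> Suc" "exceed p" v]
    perms_M_facts(2)[OF assms] by (simp_all add: inj_compose image_comp)

lemma finite_exceed: "p permutes {1..n} \<Longrightarrow> finite (exceed p)"
  using exceed_subset finite_subset by blast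

text \<open>
  Whenever an excedance value \<open>p i\<close> is at most \<open>v\<close>, so is the element \<open>p (Suc i)\<close> of \<open>U(p)\<close>
  after it; this is the ballot condition.
\<close>

lemma alpha_in_motzkin_paths:
  assumes "p \<in> perms_M n"
  shows "alpha n p \<in> motzkin_paths n"
proof -
  note p = perms_M_facts[OF assms]
  have "card {i \<in> exceed p. p i \<le> v} \<le> card {i \<in> exceed p. p (Suc i) \<le> v}" for v
    using p(3) finite_exceed[OF p(1)] by (intro card_mono) (fastforce simp: exceed_def)+
  moreover have "card (p ` exceed p) = card (p ` Suc ` exceed p)"
    using p(2) by (simp add: card_image inj_on_subset)
  ultimately show ?thesis
    by (simp add: motzkin_paths_iff places_alpha[OF assms] ranks_of_perm[OF assms])
qed

text \<open>
  The position formula \<open>i = p i + h (p i)\<close>, written additively.  Let \<open>N\<close> be the set of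
  non-excedances before \<open>i\<close>.  The \<open>i\<close> positions before \<open>i\<close> are those in \<open>N\<close> and the excedances
  \<open>j\<close> with \<open>p (Suc j) \<le> p i\<close>; the \<open>p i\<close> positions with value below \<open>p i\<close> are those in \<open>N\<close> and the
  excedances \<open>j\<close> with \<open>p j \<le> p i\<close>.  Both use that \<open>p\<close> is increasing off the excedances.
\<close>

lemma position_of_non_excedance:
  assumes "p \<in> perms_M n" "i \<notin> exceed p"
  shows "i + rank (p ` exceed p) (p i) = p i + rank (p ` Suc ` exceed p) (p i)"
proof -
  note p = perms_M_facts[OF assms(1)]
  have mono: "p j < p k \<longleftrightarrow> j < k" if "j \<notin> exceed p" "k \<notin> exceed p" for j k
    using assms(1) that strict_mono_on_less[of "- exceed p" p j k] by (simp add: perms_M_iff)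
  have fin: "finite (exceed p)" using p(1) by (rule finite_exceed)
  let ?N = "{j. j \<notin> exceed p \<and> j < i}"
  have "{..<i} = ?N \<union> {j \<in> exceed p. p (Suc j) \<le> p i}"
  proof -
    have "p (Suc j) \<le> p i \<longleftrightarrow> j < i" if "j \<in> exceed p" for j
      using mono[OF assms(2) p(4)[OF that]] by auto
    then show ?thesis by auto
  qed
  moreover have "card {..<i} = i" by simp
  ultimately have 1: "i = card ?N + card {j \<in> exceed p. p (Suc j) \<le> p i}"
    using fin by (subst card_Un_disjoint[symmetric]) auto
  have "inv p ` {..<p i} = ?N \<union> {j \<in> exceed p. p j \<le> p i}"
  proof -
    have "j \<in> inv p ` {..<p i} \<longleftrightarrow> p j < p i" for j
      using permutes_inverses[OF p(1)] by (metis image_iff lessThan_iff)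
    moreover have "p j \<le> p i \<longleftrightarrow> p j < p i" if "j \<in> exceed p" for j
      using that assms(2) p(2) by (metis inj_eq le_less)
    ultimately show ?thesis using mono assms(2) by auto
  qed
  moreover have "card (inv p ` {..<p i}) = p i"
    using permutes_inj[OF permutes_inv[OF p(1)]] by (simp add: card_image inj_on_subset)
  ultimately have 2: "p i = card ?N + card {j \<in> exceed p. p j \<le> p i}"
    using fin by (subst card_Un_disjoint[symmetric]) auto
  show ?thesis using 1 2 by (simp add: ranks_of_perm[OF assms(1)])
qed

section \<open>Injectivity\<close>

text \<open>
  At a first point of disagreement, the smaller of the two values would be attained by the other
  function neither before (there both functions agree) nor from there on (there it is larger).
\<close>

lemma strict_mono_on_unique:
  fixes f g :: "'a::wellorder \<Rightarrow> 'b::linorder"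
  assumes f: "strict_mono_on A f" and g: "strict_mono_on A g" and img: "f ` A = g ` A"
    and x: "x \<in> A"
  shows "f x = g x"
  using x
proof (induction x rule: less_induct)
  case (less x)
  have key: "\<not> f x < g x" if f: "strict_mono_on A f" and g: "strict_mono_on A g"
    and img: "f ` A = g ` A" and IH: "\<And>y. y < x \<Longrightarrow> y \<in> A \<Longrightarrow> f y = g y" for f g :: "'a \<Rightarrow> 'b"
  proof
    assume lt: "f x < g x"
    obtain y where y: "y \<in> A" "f x = g y" using img less.prems by (metis imageE imageI)
    have "y < x" using y lt strict_mono_on_leD[OF g less.prems y(1)] by force
    then show False using IH[of y] y strict_mono_onD[OF f y(1) less.prems] by simp
  qed
  show ?case using key[OF f g img] key[OF g f img[symmetric]] less.IH
    by (metis linorder_neqE)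
qed

text \<open>
  The position formula makes \<open>p\<close> and \<open>q\<close> agree off the excedances of \<open>p\<close>.  Excedances of \<open>p\<close> are
  recognized as the positions preceding an element of \<open>U(p)\<close>, so \<open>q\<close> has the same ones, and there
  both are increasing with the same image.
\<close>

lemma alpha_inj: "inj_on (alpha n) (perms_M n)"
proof (rule inj_onI)
  fix p q assume P: "p \<in> perms_M n" and Q: "q \<in> perms_M n" and eq: "alpha n p = alpha n q"
  note p = perms_M_facts[OF P] and q = perms_M_facts[OF Q]
  have D: "q ` exceed q = p ` exceed p" and U: "q ` Suc ` exceed q = p ` Suc ` exceed p"
    using places_alpha[OF P] places_alpha[OF Q] eq by simp_all
  have off: "i \<notin> exceed q \<and> q i = p i" if "i \<notin> exceed p" for i
  proof -
    obtain j where j: "q j = p i" using permutes_surj[OF q(1)] by (metis surjD)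
    have "j \<notin> exceed q" using that D j by (metis imageI inj_image_mem_iff p(2))
    then have "j = i"
      using position_of_non_excedance[OF P that] position_of_non_excedance[OF Q, of j] D U j
      by simp
    then show ?thesis using \<open>j \<notin> exceed q\<close> j by simp
  qed
  have "exceed p = exceed q"
  proof
    show "exceed q \<subseteq> exceed p" using off by blast
    show "exceed p \<subseteq> exceed q"
    proof
      fix i assume i: "i \<in> exceed p"
      then have "q (Suc i) = p (Suc i)" using off p(4) by blast
      then have "q (Suc i) \<in> q ` Suc ` exceed q" using U i by auto
      then show "i \<in> exceed q" using inj_eq[OF q(2)] by auto
    qed
  qed
  moreover from this have "p i = q i" if "i \<in> exceed p" for i
    using strict_mono_on_unique[where f = p and g = q and A = "exceed p" and x = i] D that P Q
    by (simp add: perms_M_iff)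
  ultimately show "p = q" using off by (metis ext)
qed

section \<open>Surjectivity\<close>

lemma rank_mono: "u \<le> v \<Longrightarrow> finite S \<Longrightarrow> rank S u \<le> rank S v"
  unfolding rank_def by (intro card_mono) auto

lemma rank_strict_mono:
  assumes "u < v" "v \<in> S" "finite S"
  shows "rank S u < rank S v"
proof -
  have "S \<inter> {..u} \<subseteq> S \<inter> {..v}" "v \<in> S \<inter> {..v}" "v \<notin> S \<inter> {..u}" using assms by auto
  then have "S \<inter> {..u} \<subset> S \<inter> {..v}" by blast
  then show ?thesis unfolding rank_def using assms(3) by (intro psubset_card_mono) auto
qed

lemma rank_bij:
  assumes "finite S"
  shows "bij_betw (rank S) S {1..card S}"
proof -
  have "strict_mono_on S (rank S)" using assms by (auto intro!: strict_mono_onI rank_strict_mono)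
  then have inj: "inj_on (rank S) S" by (rule strict_mono_on_imp_inj_on)
  have "rank S x \<in> {1..card S}" if "x \<in> S" for x
  proof -
    have "0 < rank S x" unfolding rank_def using that assms by (subst card_gt_0_iff) auto
    moreover have "rank S x \<le> card S" unfolding rank_def using assms by (intro card_mono) auto
    ultimately show ?thesis by simp
  qed
  then have "rank S ` S = {1..card S}"
    using inj by (intro card_subset_eq) (auto simp: card_image)
  then show ?thesis using inj by (simp add: bij_betw_def)
qed

lemma rank_diff_le:
  assumes "u \<le> v" shows "rank S v \<le> rank S u + (v - u)"
  using assms by (induction rule: dec_induct) (auto simp: rank_Suc)

text \<open>
  Here \<open>A\<close> and \<open>B\<close> are the sets of up-steps and down-steps, \<open>h\<close> is the height, \<open>g\<close> sends the
  \<open>k\<close>-th down-step to the \<open>k\<close>-th up-step, and \<open>q\<close> gives the position of each value; the permutation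
  is its inverse.
\<close>

lemma ex_perm_of_ballot_pair:
  assumes sub: "A \<subseteq> {1..n}" "B \<subseteq> {1..n}" and disj: "A \<inter> B = {}" and card: "card A = card B"
    and ballot: "\<And>v. rank B v \<le> rank A v"
  obtains p where "p \<in> perms_M n" "p ` exceed p = B" "p ` Suc ` exceed p = A"
proof -
  have fin: "finite A" "finite B" using sub finite_subset by blast+
  define h where "h v = rank A v - rank B v" for v
  have h: "rank A v = rank B v + h v" for v using ballot[of v] by (simp add: h_def)
  define g where "g = inv_into A (rank A) \<circ> rank B"
  have gbij: "bij_betw g B A"
    unfolding g_def using bij_betw_trans[OF rank_bij[OF fin(2)]]
      bij_betw_inv_into[OF rank_bij[OF fin(1)]] card by (metis comp_assoc)
  have rank_g: "rank A (g d) = rank B d" if "d \<in> B" for d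
    using that rank_bij[OF fin(1)] rank_bij[OF fin(2)] card
    by (auto simp: g_def bij_betw_def intro!: f_inv_into_f)
  define q where "q v = (if v \<in> B then g v + h (g v) - 1 else v + h v)" for v
  have gA: "g d \<in> A" if "d \<in> B" for d using gbij that by (auto simp: bij_betw_def)
  have hA: "1 \<le> h v" if "v \<in> A" for v
  proof (cases v)
    case (Suc k)
    then have "v \<notin> B" using disj that by auto
    then show ?thesis using that Suc h[of v] h[of k] by (simp add: rank_Suc)
  qed (use that sub in auto)
  \<comment> \<open>Each of the values \<open>u + 1, \<dots>, v - 1\<close> lowers the height by at most 1, and \<open>v\<close> does not lower it.\<close>
  have q_off: "q u < q v" if "u \<notin> B" "v \<notin> B" "u < v" for u v
  proof -
    obtain k where k: "v = Suc k" using \<open>u < v\<close> by (cases v) auto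
    have "rank B v \<le> rank B u + (k - u)"
      using rank_diff_le[of u k B] k that by (simp add: rank_Suc)
    then have "u + h u < v + h v"
      using rank_mono[of u v A] h[of u] h[of v] fin k that by simp
    then show ?thesis using that by (simp add: q_def)
  qed
  \<comment> \<open>Down-steps become excedances: \<open>g d < d\<close> by the ballot condition, and the height \<open>h (g d)\<close> is the
      number of down-steps in \<open>{g d <.. d}\<close>, because the
      rank of \<open>d\<close> in \<open>B\<close> is that of \<open>g d\<close> in \<open>A\<close>.\<close>
  have q_B: "q d < d" if d: "d \<in> B" for d
  proof -
    have "g d \<noteq> d" using gA[OF d] d disj by (metis disjoint_iff)
    moreover have "\<not> d < g d"
    proof
      assume lt: "d < g d"
      have "rank A d < rank A (g d)" using lt gA[OF d] fin by (intro rank_strict_mono)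
      then show False using rank_g[OF d] ballot[of d] by simp
    qed
    ultimately have "g d < d" by simp
    then show ?thesis
      using rank_diff_le[of "g d" d B] h[of "g d"] rank_g[OF d] hA[OF gA[OF d]] d
      by (simp add: q_def)
  qed
  have Suc_q: "Suc (q d) = q (g d)" if "d \<in> B" for d
    using hA[OF gA[OF that]] gA[OF that] that disj by (auto simp: q_def)
  have g_mono: "g c < g d" if "c \<in> B" "d \<in> B" "c < d" for c d
  proof -
    have "rank B c < rank B d" using that fin by (intro rank_strict_mono)
    then have "\<not> g d \<le> g c"
      using rank_mono[of "g d" "g c" A] fin rank_g[OF that(1)] rank_g[OF that(2)] by linarith
    then show ?thesis by simp
  qed
  have q_on: "q c < q d" if "c \<in> B" "d \<in> B" "c < d" for c d
    using q_off[OF _ _ g_mono[OF that]] gA that disj Suc_q by (metis Suc_less_eq disjoint_iff)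
  \<comment> \<open>At the up-step \<open>g d\<close> the position jumps by 2, so no value off \<open>B\<close> takes the place just before
      it.\<close>
  have q_ne: "q d \<noteq> q v" if d: "d \<in> B" and v: "v \<notin> B" for d v
  proof
    assume eq: "q d = q v"
    obtain k where k: "g d = Suc k" using gA[OF d] sub by (cases "g d") auto
    have gB: "g d \<notin> B" using gA[OF d] disj by auto
    have "v < g d" using Suc_q[OF d] q_off[OF gB v] eq
      by (metis lessI less_irrefl linorder_neqE_nat not_less_iff_gr_or_eq order_less_trans)
    have "rank B k \<le> rank B v + (k - v)" "rank A v \<le> rank A k"
      using rank_diff_le[of v k B] rank_mono[of v k A] \<open>v < g d\<close> k fin by simp_all
    then have "q v + 2 \<le> q (g d)"
      using h[of v] h[of "g d"] gB v gA[OF d] k \<open>v < g d\<close> by (simp add: q_def rank_Suc)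
    then show False using eq Suc_q[OF d] by simp
  qed
  have inj: "inj q"
  proof (rule injI, rule ccontr)
    fix u v assume "q u = q v" "u \<noteq> v"
    then show False using q_on[of u v] q_on[of v u] q_off[of u v] q_off[of v u] q_ne[of u v]
      q_ne[of v u] by (metis less_irrefl linorder_neqE_nat)
  qed
  have fix_out: "q v = v" if "v \<notin> {1..n}" for v
  proof -
    have "rank A v = rank B v"
    proof (cases "v = 0")
      case True
      then have "A \<inter> {..v} = {}" "B \<inter> {..v} = {}" using sub by force+
      then show ?thesis by (simp add: rank_def)
    next
      case False
      then show ?thesis using that rank_full[OF sub(1)] rank_full[OF sub(2)] card by simp
    qed
    then show ?thesis using that sub by (auto simp: q_def h_def)
  qed
  have "q v \<in> {1..n}" if "v \<in> {1..n}" for v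
  proof (rule ccontr)
    assume "q v \<notin> {1..n}"
    then have "q (q v) = q v" by (rule fix_out)
    then show False using inj \<open>q v \<notin> {1..n}\<close> that by (simp add: inj_eq)
  qed
  then have "q ` {1..n} \<subseteq> {1..n}" by blast
  then have "q ` {1..n} = {1..n}" by (intro endo_inj_surj inj_on_subset[OF inj]) simp_all
  then have "bij_betw q {1..n} {1..n}"
    using inj_on_subset[OF inj, of "{1..n}"] by (simp add: bij_betw_def)
  then have perm: "q permutes {1..n}" using fix_out by (rule bij_imp_permutes)
  define p where "p = inv q"
  have p: "p permutes {1..n}" unfolding p_def using perm by (rule permutes_inv)
  have pq: "p (q v) = v" and qp: "q (p i) = i" for v i
    using permutes_inverses[OF perm] by (simp_all add: p_def)
  \<comment> \<open>Off \<open>B\<close> the position \<open>v + h v\<close> is at least \<open>v\<close>, so the excedance values are exactly \<open>B\<close>.\<close>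
  have ex: "i \<in> exceed p \<longleftrightarrow> p i \<in> B" for i
  proof -
    have "i \<in> exceed p \<longleftrightarrow> q (p i) < p i" by (simp add: exceed_def qp)
    also have "\<dots> \<longleftrightarrow> p i \<in> B" using q_B[of "p i"] by (auto simp: q_def split: if_splits)
    finally show ?thesis .
  qed
  have Suc_p: "p (Suc i) = g (p i)" if "i \<in> exceed p" for i
    using Suc_q[of "p i"] that ex pq qp by metis
  have mono: "p i < p j" if "p i \<in> B \<longleftrightarrow> p j \<in> B" "i < j" for i j
    using that q_on[of "p j" "p i"] q_off[of "p j" "p i"] qp
    by (metis linorder_neqE_nat order_less_asym)
  have "p (Suc i) \<le> i" if "i \<in> exceed p" for i
  proof -
    have "p i \<in> B" using that ex by simp
    then have "i = g (p i) + h (g (p i)) - 1" using qp[of i] by (simp add: q_def)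
    then show ?thesis using hA[OF gA[OF \<open>p i \<in> B\<close>]] Suc_p[OF that] by simp
  qed
  then have "p \<in> perms_M n"
    using p mono ex by (simp add: perms_M_iff strict_mono_on_def)
  moreover have img: "p ` exceed p = B"
  proof
    show "p ` exceed p \<subseteq> B" using ex by blast
    show "B \<subseteq> p ` exceed p"
    proof
      fix v assume "v \<in> B"
      then have "q v \<in> exceed p" by (simp add: ex pq)
      then have "p (q v) \<in> p ` exceed p" by (rule imageI)
      then show "v \<in> p ` exceed p" by (simp add: pq)
    qed
  qed
  moreover have "p ` Suc ` exceed p = A"
  proof -
    have "p ` Suc ` exceed p = g ` p ` exceed p" using Suc_p by (auto simp: image_image)
    also have "\<dots> = A" using gbij img by (simp add: bij_betw_def)
    finally show ?thesis .
  qed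
  ultimately show thesis by (rule that)
qed

section \<open>The two bijections\<close>

lemma alpha_bij: "bij_betw (alpha n) (perms_M n) (motzkin_paths n)"
proof -
  have "w \<in> alpha n ` perms_M n" if w: "w \<in> motzkin_paths n" for w
  proof -
    have len: "length w = n" using w by (simp add: motzkin_paths_iff)
    have disj: "places U w \<inter> places D w = {}" by (auto simp: places_def)
    obtain p where p: "p \<in> perms_M n" "p ` exceed p = places D w" "p ` Suc ` exceed p = places U w"
      using ex_perm_of_ballot_pair[of "places U w" n "places D w"] places_subset[of _ w] len disj w
      by (auto simp: motzkin_paths_iff)
    then have "alpha n p = w" using len places_alpha[OF p(1)] by (intro word_eqI) auto
    then show ?thesis using p(1) by blast
  qed
  then show ?thesis using alpha_inj alpha_in_motzkin_paths by (auto simp: bij_betw_def)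
qed

text \<open>
  By the position formula, a value \<open>v\<close> outside \<open>D(p)\<close> is fixed iff the height after \<open>v\<close> letters
  vanishes; at a level step this is also the height before it.  Values of up-steps and down-steps are
  never fixed.
\<close>

lemma alpha_riordan_iff:
  assumes P: "p \<in> perms_M n"
  shows "alpha n p \<in> riordan_paths n \<longleftrightarrow> p \<in> perms_R n"
proof -
  note p = perms_M_facts[OF P]
  have "alpha n p ! k = H \<and> height (take k (alpha n p)) = 0 \<longleftrightarrow> p (Suc k) = Suc k" if k: "k < n" for k
  proof -
    let ?U = "p ` Suc ` exceed p" and ?D = "p ` exceed p"
    have flat: "alpha n p ! k = H \<longleftrightarrow> Suc k \<notin> ?U \<and> Suc k \<notin> ?D"
      using k by (simp add: nth_alpha D_set_eq[OF P] U_set_eq[OF P])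
    have h: "height (take k (alpha n p)) = 0 \<longleftrightarrow> rank ?U (Suc k) = rank ?D (Suc k)"
      if "Suc k \<notin> ?U \<and> Suc k \<notin> ?D"
      using that k height_take_rank[of k "alpha n p"] by (simp add: places_alpha[OF P] rank_Suc)
    obtain i where i: "p i = Suc k" using permutes_surj[OF p(1)] by (metis surjD)
    show ?thesis
    proof (cases "Suc k \<notin> ?U \<and> Suc k \<notin> ?D")
      case True
      then have "i \<notin> exceed p" using i by (metis imageI)
      then have "rank ?U (Suc k) = rank ?D (Suc k) \<longleftrightarrow> i = Suc k"
        using position_of_non_excedance[OF P, of i] i by auto
      also have "\<dots> \<longleftrightarrow> p (Suc k) = Suc k" using i inj_eq[OF p(2)] by metis
      finally show ?thesis using flat h True by simp
    next
      case False
      then obtain j where "j \<in> exceed p" "Suc k = p j \<or> Suc k = p (Suc j)" by blast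
      then have "p (Suc k) \<noteq> Suc k"
        using p(3)[of j] inj_eq[OF p(2)] by (auto simp: exceed_def)
      then show ?thesis using flat False by auto
    qed
  qed
  moreover have "(\<forall>i\<in>{1..n}. p i \<noteq> i) \<longleftrightarrow> (\<forall>k<n. p (Suc k) \<noteq> Suc k)"
    unfolding image_Suc_lessThan[symmetric] by blast
  ultimately show ?thesis
    using P alpha_in_motzkin_paths[OF P] by (auto simp: riordan_paths_def perms_R_def)
qed

theorem theorem2p1:
  fixes n :: nat
  shows "bij_betw (alpha n) (perms_M n) (motzkin_paths n) \<and>
         bij_betw (alpha n) (perms_R n) (riordan_paths n)"
proof
  show M: "bij_betw (alpha n) (perms_M n) (motzkin_paths n)" by (rule alpha_bij)
  have sub: "perms_R n \<subseteq> perms_M n" "riordan_paths n \<subseteq> motzkin_paths n"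
    by (auto simp: perms_R_def riordan_paths_def)
  have "alpha n ` perms_R n = riordan_paths n"
  proof
    show "alpha n ` perms_R n \<subseteq> riordan_paths n" using sub(1) alpha_riordan_iff by blast
    show "riordan_paths n \<subseteq> alpha n ` perms_R n"
    proof
      fix w assume w: "w \<in> riordan_paths n"
      then obtain p where "p \<in> perms_M n" "w = alpha n p"
        using M sub(2) by (auto simp: bij_betw_def)
      then show "w \<in> alpha n ` perms_R n" using w alpha_riordan_iff by blast
    qed
  qed
  then show "bij_betw (alpha n) (perms_R n) (riordan_paths n)"
    using bij_betw_subset[OF M sub(1)] by simp
qed

end
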